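(* Let $d,g,h,t\geq 1$ and $r\geq 0$ be integers. Let $G$ be a $(K_{2,2},K_t)$-free graph and let $Z\subseteq V(G)$ with $|Z|\leq h$. Let $Z_0=\{z_1,z_2,z\}\subseteq Z$ be a $3$-clique such that the set of neighbors of $z$ in $Z$ is $\{z_1,z_2\}$. Let $\mathfrak{p}=(Z_0,\ldots,Z_r;\Gamma_i:i\in[r])$ be a $(Z_0,d+g+2^ht,r)$-phantom in $G$ such that $Z_r\cap Z=Z_0$. Then one of the following holds. (a) There exists a $(z_1,z_2,1,g)$-crystal $\mathfrak{c}$ in $G[Z_r]$ such that $V(\mathfrak{c})$ is anticomplete to $Z\setminus Z_0$. (b) $G$ has a (not necessarily induced) subgraph $U$ isomorphic to $T_{d,r}$ such that: $U$ contains $z$ as its root; $\{z_1,z_2\}$ is disjoint from $V(U)$ and every vertex of $\{z_1,z_2\}$ is adjacent in $G$ to every vertex of $V(U)$; and for every $i\in[r]$, every $u\in V(U)$ at distance $i$ in $U$ from $z$, with $u^-$ the parent of $u$ in $U$, we have $u\in\Gamma_i(u^-z_1)\cup\Gamma_i(u^-z_2)\subseteq Z_i\setminus Z_{i-1}$. In particular, $V(U)\cap Z=\{z\}$.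
   Context: Graphs are finite and simple; $G$ is $X$-free if no induced subgraph is isomorphic to $X$; sets of vertices are anticomplete if there is no edge between them; a $c$-clique is a clique of size $c$; $[n]=\{1,\ldots,n\}$. For $Z_0\subseteq V(G)$ and integers $d'\geq1$, $r\geq0$, a $(Z_0,d',r)$-phantom in $G$ is a tuple $(Z_0,\ldots,Z_r;\Gamma_i:i\in[r])$ with $Z_0\subseteq\cdots\subseteq Z_r\subseteq V(G)$ such that for every $i\in[r]$, $\Gamma_i$ is a map with domain $E(G[Z_{i-1}])$, where for each edge $e$, $\Gamma_i(e)\subseteq Z_i\setminus Z_{i-1}$, $|\Gamma_i(e)|=d'$, both ends of $e$ are adjacent to all of $\Gamma_i(e)$, and distinct edges have disjoint images. For adjacent $z_1,z_2$ and integers $f',g'\geq1$, a $(z_1,z_2,f',g')$-crystal in a graph $G'$ is a tuple $(S_{1,w},w,S_{2,w}:w\in S)$ with $S$ an $f'$-subset of $V(G')\setminus\{z_1,z_2\}$, the sets $S_{1,w},S_{2,w}$ ($w\in S$) pairwise disjoint $g'$-subsets of $V(G')\setminus(S\cup\{z_1,z_2\})$, and for each $i\in\{1,2\}$, $w\in S$, $x\in S_{i,w}$, the neighbors of $x$ in $\{z_1,z_2,w\}$ are exactly $\{z_i,w\}$; $V(\mathfrak{c})=S\cup\bigcup_{w\in S}(S_{1,w}\cup S_{2,w})$. $T_{d,r}$ is the rooted tree of radius $r$ whose root has degree $d$ (if $r\geq1$) and whose other non-leaf vertices have degree $d+1$. For vertices $u,v$, $uv$ denotes the edge between them. *)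

theory Defs
  imports
    "HOL-Library.Disjoint_Sets"
    "Graph_Theory.Digraph_Isomorphism"
    "Graph_Theory.Pair_Digraph"
    "Graph_Theory.Kuratowski"
begin

text \<open>
  Finite simple graphs are rendered, as in the \<open>Graph_Theory\<close> library, as finite symmetric loopless
  digraphs (locale \<^locale>\<open>pair_graph\<close>), an edge \<open>uv\<close> being represented by the two arcs
  \<open>(u,v)\<close> and \<open>(v,u)\<close>.  The predicates \<open>K\<^bsub>n\<^esub>\<close> and \<open>K\<^bsub>m,n\<^esub>\<close> of the library say that a graph is (a copy of)
  the complete, respectively complete bipartite, graph.
\<close>

definition free_of ::
    "('a,'b) pre_digraph \<Rightarrow> (('a,'b) pre_digraph \<Rightarrow> bool) \<Rightarrow> bool" where
  "free_of G X \<longleftrightarrow> \<not> (\<exists>H. induced_subgraph H G \<and> X H)"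

definition edges :: "('a,'b) pre_digraph \<Rightarrow> 'a set set" where
  "edges G = {{u, v} | u v. u \<rightarrow>\<^bsub>G\<^esub> v}"

definition clique :: "('a,'b) pre_digraph \<Rightarrow> nat \<Rightarrow> 'a set \<Rightarrow> bool" where
  "clique G c K \<longleftrightarrow> K \<subseteq> verts G \<and> card K = c \<and> (\<forall>u\<in>K. \<forall>v\<in>K. u \<noteq> v \<longrightarrow> u \<rightarrow>\<^bsub>G\<^esub> v)"

definition anticomplete :: "('a,'b) pre_digraph \<Rightarrow> 'a set \<Rightarrow> 'a set \<Rightarrow> bool" where
  "anticomplete G A B \<longleftrightarrow> (\<forall>a\<in>A. \<forall>b\<in>B. \<not> a \<rightarrow>\<^bsub>G\<^esub> b \<and> \<not> b \<rightarrow>\<^bsub>G\<^esub> a)"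

text \<open>
  The maps \<open>\<Gamma> i\<close> are total functions; only their values on the edges of \<open>G[Z (i - 1)]\<close> and
  the sets \<open>Z 0, \<dots>, Z r\<close> matter.
\<close>

definition phantom ::
    "('a,'b) pre_digraph \<Rightarrow> 'a set \<Rightarrow> nat \<Rightarrow> nat \<Rightarrow> (nat \<Rightarrow> 'a set) \<Rightarrow> (nat \<Rightarrow> 'a set \<Rightarrow> 'a set) \<Rightarrow> bool"
  where
  "phantom G Z\<^sub>0 d r Z \<Gamma> \<longleftrightarrow>
     Z 0 = Z\<^sub>0 \<and> (\<forall>i\<in>{1..r}. Z (i - 1) \<subseteq> Z i) \<and> Z r \<subseteq> verts G \<and>
     (\<forall>i\<in>{1..r}.
        (\<forall>e\<in>edges (G \<restriction> Z (i - 1)).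
           \<Gamma> i e \<subseteq> Z i - Z (i - 1) \<and> card (\<Gamma> i e) = d \<and>
           (\<forall>u\<in>e. \<forall>x\<in>\<Gamma> i e. u \<rightarrow>\<^bsub>G\<^esub> x)) \<and>
        disjoint_family_on (\<Gamma> i) (edges (G \<restriction> Z (i - 1))))"

text \<open>\<open>T i w\<close> (\<open>i \<in> {1, 2}\<close>) is the set written \<open>S\<^bsub>i,w\<^esub>\<close> on paper.\<close>

definition crystal ::
    "('a,'b) pre_digraph \<Rightarrow> 'a \<Rightarrow> 'a \<Rightarrow> nat \<Rightarrow> nat \<Rightarrow> 'a set \<Rightarrow> (nat \<Rightarrow> 'a \<Rightarrow> 'a set) \<Rightarrow> bool"
  where
  "crystal G z\<^sub>1 z\<^sub>2 f g S T \<longleftrightarrow>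
     z\<^sub>1 \<rightarrow>\<^bsub>G\<^esub> z\<^sub>2 \<and>
     S \<subseteq> verts G - {z\<^sub>1, z\<^sub>2} \<and> card S = f \<and>
     (\<forall>i\<in>{1,2}. \<forall>w\<in>S. T i w \<subseteq> verts G - (S \<union> {z\<^sub>1, z\<^sub>2}) \<and> card (T i w) = g) \<and>
     disjoint_family_on (\<lambda>(i, w). T i w) ({1,2} \<times> S) \<and>
     (\<forall>w\<in>S. \<forall>x\<in>T 1 w. {y \<in> {z\<^sub>1, z\<^sub>2, w}. x \<rightarrow>\<^bsub>G\<^esub> y} = {z\<^sub>1, w}) \<and>
     (\<forall>w\<in>S. \<forall>x\<in>T 2 w. {y \<in> {z\<^sub>1, z\<^sub>2, w}. x \<rightarrow>\<^bsub>G\<^esub> y} = {z\<^sub>2, w})"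

definition crystal_verts :: "'a set \<Rightarrow> (nat \<Rightarrow> 'a \<Rightarrow> 'a set) \<Rightarrow> 'a set" where
  "crystal_verts S T = S \<union> (\<Union>w\<in>S. T 1 w \<union> T 2 w)"

text \<open>
  The rooted tree \<open>T\<^bsub>d,r\<^esub>\<close>: the vertices are the words of length at most \<open>r\<close> over an alphabet of size
  \<open>d\<close>, the root is the empty word, and the children of a word of length less than \<open>r\<close> are its \<open>d\<close>
  one-letter extensions; in particular all leaves other than possibly the root have depth \<open>r\<close>.
\<close>

definition dary_tree :: "nat \<Rightarrow> nat \<Rightarrow> nat list pair_pre_digraph" where
  "dary_tree d r =
     (let V = {xs. length xs \<le> r \<and> set xs \<subseteq> {..<d}} in
      \<lparr> pverts = V,
        parcs = {(xs, ys) \<in> V \<times> V. \<exists>a. ys = xs @ [a] \<or> xs = ys @ [a]} \<rparr>)"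

definition rooted_iso ::
    "('a,'b) pre_digraph \<Rightarrow> 'a \<Rightarrow> ('c,'d) pre_digraph \<Rightarrow> 'c \<Rightarrow> bool" where
  "rooted_iso G x H y \<longleftrightarrow>
     x \<in> verts G \<and>
     (\<exists>f. pre_digraph.digraph_isomorphism G f \<and> H = app_iso f G \<and> iso_verts f x = y)"

text \<open>
  Number of edges of a shortest walk; only meaningful if \<open>v\<close> is reachable from \<open>u\<close>.
\<close>

definition hop_dist :: "('a,'b) pre_digraph \<Rightarrow> 'a \<Rightarrow> 'a \<Rightarrow> nat" where
  "hop_dist G u v = (LEAST n. \<exists>p. pre_digraph.awalk G u p v \<and> length p = n)"

text \<open>
  Parent of a vertex \<open>u\<close> other than the root \<open>z\<close> in a tree \<open>U\<close>: the unique neighbour of \<open>u\<close> that is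
  closer to \<open>z\<close>.
\<close>

definition parent :: "('a,'b) pre_digraph \<Rightarrow> 'a \<Rightarrow> 'a \<Rightarrow> 'a" where
  "parent U z u = (THE w. w \<rightarrow>\<^bsub>U\<^esub> u \<and> hop_dist U z w < hop_dist U z u)"

end

theory Submission
  imports Defs
begin

text \<open>
  The tree is grown level by level, keeping every vertex of it complete to \<open>{z\<^sub>1, z\<^sub>2}\<close> and
  anticomplete to \<open>Z - Z\<^sub>0\<close>.  Let \<open>u\<close> be a leaf.  A vertex \<open>y \<in> Z - Z\<^sub>0\<close> is not adjacent to \<open>u\<close>, so
  the common neighbours of \<open>u\<close> and \<open>y\<close> form a clique (two nonadjacent ones would give an induced
  \<open>K\<^bsub>2,2\<^esub>\<close>) and there are fewer than \<open>t\<close> of them.  Hence at least \<open>d + g\<close> vertices of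
  \<open>\<Gamma> i {u, z\<^sub>1}\<close>, and as many of \<open>\<Gamma> i {u, z\<^sub>2}\<close>, are anticomplete to \<open>Z - Z\<^sub>0\<close>.  Either \<open>d\<close> vertices
  of one of these sets are adjacent to both \<open>z\<^sub>1\<close> and \<open>z\<^sub>2\<close>, and they serve as the children of \<open>u\<close>, or
  each set has \<open>g\<close> vertices that miss the other \<open>z\<^sub>j\<close>, and these form a crystal around \<open>u\<close>.
\<close>

section \<open>Graphs without induced complete (bipartite) subgraphs\<close>

lemma dominates_induce_iff:
  "u \<rightarrow>\<^bsub>G \<restriction> S\<^esub> v \<longleftrightarrow> u \<rightarrow>\<^bsub>G\<^esub> v \<and> u \<in> S \<and> v \<in> S"
  by (auto simp: arcs_ends_conv)

lemma edge_in_edges_induce: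
  assumes "u \<rightarrow>\<^bsub>G\<^esub> v" "u \<in> S" "v \<in> S"
  shows "{u, v} \<in> edges (G \<restriction> S)"
  using assms unfolding edges_def dominates_induce_iff by blast

text \<open>An induced subgraph kept in pair form, since the characterisations of complete and
  complete bipartite graphs used below speak of \<open>pverts\<close> and
  \<open>parcs\<close>.\<close>

definition pinduce :: "'a pair_pre_digraph \<Rightarrow> 'a set \<Rightarrow> 'a pair_pre_digraph" where
  "pinduce G S = \<lparr> pverts = S, parcs = parcs G \<inter> S \<times> S \<rparr>"

lemma induced_subgraph_pinduce:
  assumes "pair_graph G" "S \<subseteq> pverts G"
  shows "induced_subgraph (with_proj (pinduce G S)) (with_proj G)"
proof -
  interpret pair_graph G by fact
  have "with_proj (pinduce G S) = with_proj G \<restriction> S"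
    by (auto simp: pinduce_def with_proj_def induce_subgraph_def)
  then show ?thesis
    using induced_induce[of S] assms(2) by simp
qed

context pair_graph
begin

lemma adj_sym: "u \<rightarrow>\<^bsub>with_proj G\<^esub> v \<Longrightarrow> v \<rightarrow>\<^bsub>with_proj G\<^esub> u"
  using arcs_symmetric by simp

lemma K22_freeD:
  assumes free: "free_of G K\<^bsub>2,2\<^esub>"
    and "a \<rightarrow>\<^bsub>G\<^esub> x" "a \<rightarrow>\<^bsub>G\<^esub> y" "b \<rightarrow>\<^bsub>G\<^esub> x" "b \<rightarrow>\<^bsub>G\<^esub> y"
    and "a \<noteq> b" "x \<noteq> y" "\<not> a \<rightarrow>\<^bsub>G\<^esub> b"
  shows "x \<rightarrow>\<^bsub>G\<^esub> y"
proof (rule ccontr)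
  assume nxy: "\<not> x \<rightarrow>\<^bsub>G\<^esub> y"
  let ?S = "{a, b, x, y}"
  have adj: "(a, x) \<in> parcs G" "(a, y) \<in> parcs G" "(b, x) \<in> parcs G" "(b, y) \<in> parcs G"
    using assms(2-5) by simp_all
  then have adj': "(x, a) \<in> parcs G" "(y, a) \<in> parcs G" "(x, b) \<in> parcs G" "(y, b) \<in> parcs G"
    by (simp_all add: arcs_symmetric)
  have non: "(a, b) \<notin> parcs G" "(b, a) \<notin> parcs G" "(x, y) \<notin> parcs G" "(y, x) \<notin> parcs G"
    using \<open>\<not> a \<rightarrow>\<^bsub>G\<^esub> b\<close> nxy arcs_symmetric by auto
  have loop: "(v, v) \<notin> parcs G" for v
    using no_loops' by blast
  have ne: "a \<noteq> x" "a \<noteq> y" "b \<noteq> x" "b \<noteq> y"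
    using adj loop by auto
  have "?S \<subseteq> pverts G"
    using adj by (auto dest: wellformed')
  then have "induced_subgraph (with_proj (pinduce G ?S)) (with_proj G)"
    by (intro induced_subgraph_pinduce pair_graph)
  moreover have "K\<^bsub>2,2\<^esub> (with_proj (pinduce G ?S))"
  proof -
    have "parcs (pinduce G ?S) = {a, b} \<times> {x, y} \<union> {x, y} \<times> {a, b}"
      using adj adj' non loop by (auto simp: pinduce_def)
    moreover have "pverts (pinduce G ?S) = {a, b} \<union> {x, y}"
      by (auto simp: pinduce_def)
    moreover have "{a, b} \<inter> {x, y} = {}" "card {a, b} = 2" "card {x, y} = 2"
      using ne \<open>a \<noteq> b\<close> \<open>x \<noteq> y\<close> by simp_all
    ultimately show ?thesis
      unfolding complete_bipartite_digraph_pair_def by (metis finite.emptyI finite.insertI finite_Un)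
  qed
  ultimately show False
    using free unfolding free_of_def by blast
qed

text \<open>Any \<open>t\<close> vertices of a clique with at least \<open>t\<close> vertices induce
  a complete graph.\<close>

lemma clique_card_less:
  assumes free: "free_of G K\<^bsub>t\<^esub>" and K: "clique G c K"
  shows "c < t"
proof (rule ccontr)
  assume "\<not> c < t"
  then obtain S where S: "S \<subseteq> K" "card S = t" "finite S"
    using K obtain_subset_with_card_n[of t K] unfolding clique_def by auto
  have "S \<subseteq> pverts G"
    using S K by (auto simp: clique_def)
  then have "induced_subgraph (with_proj (pinduce G S)) (with_proj G)"
    by (intro induced_subgraph_pinduce pair_graph)
  moreover have "K\<^bsub>t\<^esub> (with_proj (pinduce G S))"
    unfolding complete_digraph_pair_def
    using S K no_loops' by (fastforce simp: pinduce_def clique_def)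
  ultimately show False
    using free unfolding free_of_def by blast
qed

text \<open>Any two members of \<open>X\<close> have the nonadjacent vertices \<open>u\<close> and
  \<open>y\<close> as common neighbours, so \<open>K22_freeD\<close> makes \<open>X\<close> a
  clique.\<close>

lemma card_common_neighbours_less:
  assumes "free_of G K\<^bsub>2,2\<^esub>" "free_of G K\<^bsub>t\<^esub>"
    and "u \<noteq> y" "\<not> u \<rightarrow>\<^bsub>G\<^esub> y"
    and X: "\<And>x. x \<in> X \<Longrightarrow> u \<rightarrow>\<^bsub>G\<^esub> x \<and> y \<rightarrow>\<^bsub>G\<^esub> x"
  shows "card X < t"
proof -
  have "X \<subseteq> pverts G"
    using X by (auto dest: wellformed')
  then have "clique G (card X) X"
    unfolding clique_def using X K22_freeD[OF assms(1), of u _ _ y] assms(3,4) by auto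
  then show ?thesis
    using clique_card_less assms(2) by blast
qed

text \<open>Union bound over \<open>W\<close>: each \<open>y\<close> in \<open>W\<close> is distinct
  from \<open>u\<close> and not adjacent to it, so it shares fewer than \<open>t\<close> neighbours
  with \<open>u\<close>.\<close>

lemma card_neighbours_of_set_le:
  assumes "free_of G K\<^bsub>2,2\<^esub>" "free_of G K\<^bsub>t\<^esub>"
    and "finite W" "u \<notin> W"
    and W: "\<And>y. y \<in> W \<Longrightarrow> \<not> u \<rightarrow>\<^bsub>G\<^esub> y"
    and X: "\<And>x. x \<in> X \<Longrightarrow> u \<rightarrow>\<^bsub>G\<^esub> x"
  shows "card {x \<in> X. \<exists>y\<in>W. y \<rightarrow>\<^bsub>G\<^esub> x} \<le> card W * t"
proof -
  have eq: "{x \<in> X. \<exists>y\<in>W. y \<rightarrow>\<^bsub>G\<^esub> x} = (\<Union>y\<in>W. {x \<in> X. y \<rightarrow>\<^bsub>G\<^esub> x})"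
    by blast
  have "card {x \<in> X. y \<rightarrow>\<^bsub>G\<^esub> x} \<le> t" if "y \<in> W" for y
    using card_common_neighbours_less[OF assms(1,2), of u y "{x \<in> X. y \<rightarrow>\<^bsub>G\<^esub> x}"] that assms(4) W X
    by fastforce
  then have "(\<Sum>y\<in>W. card {x \<in> X. y \<rightarrow>\<^bsub>G\<^esub> x}) \<le> card W * t"
    using sum_bounded_above[of W _ t] by (metis (no_types, lifting) of_nat_id)
  then show ?thesis
    unfolding eq using card_UN_le[OF \<open>finite W\<close>, of "\<lambda>y. {x \<in> X. y \<rightarrow>\<^bsub>G\<^esub> x}"] by linarith
qed

text \<open>Crystals with a single centre \<open>w\<close>. The inequalities such as
  \<open>x \<noteq> z\<^sub>2\<close> are separate conditions because \<open>z\<^sub>2\<close> is a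
  neighbour of \<open>z\<^sub>1\<close>, not of itself, and possibly of \<open>w\<close>, so
  adjacency alone does not keep it out of \<open>A\<close>. The other exclusions follow from the
  absence of loops.\<close>

lemma crystal_singletonI:
  assumes "z\<^sub>1 \<rightarrow>\<^bsub>G\<^esub> z\<^sub>2" "z\<^sub>1 \<in> V" "z\<^sub>2 \<in> V" "w \<in> V" "w \<noteq> z\<^sub>1" "w \<noteq> z\<^sub>2"
    and "A \<subseteq> V" "B \<subseteq> V" "card A = g" "card B = g" "A \<inter> B = {}"
    and A: "\<And>x. x \<in> A \<Longrightarrow> w \<rightarrow>\<^bsub>G\<^esub> x \<and> z\<^sub>1 \<rightarrow>\<^bsub>G\<^esub> x \<and> \<not> z\<^sub>2 \<rightarrow>\<^bsub>G\<^esub> x \<and> x \<noteq> z\<^sub>2"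
    and B: "\<And>x. x \<in> B \<Longrightarrow> w \<rightarrow>\<^bsub>G\<^esub> x \<and> z\<^sub>2 \<rightarrow>\<^bsub>G\<^esub> x \<and> \<not> z\<^sub>1 \<rightarrow>\<^bsub>G\<^esub> x \<and> x \<noteq> z\<^sub>1"
  shows "crystal (G \<restriction> V) z\<^sub>1 z\<^sub>2 1 g {w} (\<lambda>i _. if i = 1 then A else B)"
proof -
  have loop: "\<not> v \<rightarrow>\<^bsub>G\<^esub> v" for v
    using no_loops' by auto
  have nbrA: "{y \<in> {z\<^sub>1, z\<^sub>2, w}. x \<rightarrow>\<^bsub>G \<restriction> V\<^esub> y} = {z\<^sub>1, w}" if "x \<in> A" for x
    using A[OF that] that assms(2-8) adj_sym unfolding dominates_induce_iff by blast
  have nbrB: "{y \<in> {z\<^sub>1, z\<^sub>2, w}. x \<rightarrow>\<^bsub>G \<restriction> V\<^esub> y} = {z\<^sub>2, w}" if "x \<in> B" for x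
    using B[OF that] that assms(2-8) adj_sym unfolding dominates_induce_iff by blast
  have "A \<inter> {w, z\<^sub>1, z\<^sub>2} = {}" "B \<inter> {w, z\<^sub>1, z\<^sub>2} = {}"
    using A B loop by blast+
  moreover have "z\<^sub>1 \<rightarrow>\<^bsub>G \<restriction> V\<^esub> z\<^sub>2"
    using assms(1-3) by (simp only: dominates_induce_iff)
  moreover have "disjoint_family_on (\<lambda>(i, w). if i = 1 then A else B) ({1, 2 :: nat} \<times> {w})"
    using \<open>A \<inter> B = {}\<close> by (auto simp: disjoint_family_on_def)
  ultimately show ?thesis
    unfolding crystal_def using assms(2-10) nbrA nbrB by auto
qed

end

section \<open>Images of the rooted tree\<close>

abbreviation dary_words :: "nat \<Rightarrow> nat \<Rightarrow> nat list set" where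
  "dary_words d r \<equiv> pverts (dary_tree d r)"

lemma dary_words_iff: "xs \<in> dary_words d r \<longleftrightarrow> length xs \<le> r \<and> set xs \<subseteq> {..<d}"
  by (simp add: dary_tree_def Let_def)

lemma dary_arcs_iff:
  "(xs, ys) \<in> parcs (dary_tree d r) \<longleftrightarrow>
     xs \<in> dary_words d r \<and> ys \<in> dary_words d r \<and> (\<exists>a. ys = xs @ [a] \<or> xs = ys @ [a])"
  by (simp add: dary_tree_def Let_def)

definition map_pdigraph :: "('a \<Rightarrow> 'b) \<Rightarrow> 'a pair_pre_digraph \<Rightarrow> 'b pair_pre_digraph" where
  "map_pdigraph f G = \<lparr> pverts = f ` pverts G, parcs = map_prod f f ` parcs G \<rparr>"

lemma map_pdigraph_simps [simp]:
  "pverts (map_pdigraph f G) = f ` pverts G"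
  "parcs (map_pdigraph f G) = map_prod f f ` parcs G"
  by (simp_all add: map_pdigraph_def)

text \<open>The isomorphism acts on arcs by \<open>map_prod f f\<close> and keeps \<open>fst\<close>
  and \<open>snd\<close> as tail and head. It is injective on arcs because their ends are vertices,
  where \<open>f\<close> is injective.\<close>

lemma rooted_iso_map_pdigraph:
  assumes "pair_wf_digraph G" "inj_on f (pverts G)" "x \<in> pverts G"
  shows "rooted_iso (with_proj G) x (with_proj (map_pdigraph f G)) (f x)"
proof -
  interpret pair_wf_digraph G by fact
  let ?f = "\<lparr> iso_verts = f, iso_arcs = map_prod f f, iso_head = snd, iso_tail = fst \<rparr>"
  have "parcs G \<subseteq> pverts G \<times> pverts G"
    using arc_fst_in_verts arc_snd_in_verts by force
  then have "inj_on (map_prod f f) (parcs G)"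
    using map_prod_inj_on[OF assms(2) assms(2)] inj_on_subset by blast
  then have "pre_digraph.digraph_isomorphism (with_proj G) ?f"
    unfolding digraph_isomorphism_def using assms(2) wf_digraph by simp
  moreover have "with_proj (map_pdigraph f G) = app_iso ?f (with_proj G)"
    by (simp add: with_proj_def app_iso_def)
  ultimately show ?thesis
    unfolding rooted_iso_def using assms(3) by (intro conjI exI[of _ ?f]) simp_all
qed

section \<open>Distances and parents in an injective image of the rooted tree\<close>

lemma pair_wf_digraph_dary_tree: "pair_wf_digraph (dary_tree d r)"
  by unfold_locales (auto simp: dary_arcs_iff)

text \<open>If no arc of a walk climbs more than one level, the walk climbs at most its length. This
  gives the lower bound on distances from the root.\<close>

lemma pcas_level_le:
  assumes "\<And>e. e \<in> set p \<Longrightarrow> lev (snd e) \<le> Suc (lev (fst e))" "pcas u p v"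
  shows "lev v \<le> lev u + length p"
  using assms
proof (induction p arbitrary: u)
  case (Cons e p)
  then have "lev v \<le> lev (snd e) + length p" "lev (snd e) \<le> Suc (lev u)"
    by auto
  then show ?case by simp
qed simp

lemma pcas_snoc: "pcas u (p @ [e]) v \<longleftrightarrow> pcas u p (fst e) \<and> snd e = v"
  by (induction p arbitrary: u) auto

locale dary_image =
  fixes f :: "nat list \<Rightarrow> 'a" and d r :: nat
  assumes inj: "inj_on f (dary_words d r)"
begin

abbreviation U :: "'a pair_pre_digraph" where
  "U \<equiv> map_pdigraph f (dary_tree d r)"

abbreviation level :: "'a \<Rightarrow> nat" where
  "level v \<equiv> length (the_inv_into (dary_words d r) f v)"

lemma level_f: "xs \<in> dary_words d r \<Longrightarrow> level (f xs) = length xs"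
  using inj by (simp add: the_inv_into_f_f)

text \<open>The walk through the prefixes of \<open>xs\<close> has \<open>length xs\<close> arcs. No
  walk is shorter, since an arc of the image changes word length by exactly one.\<close>

lemma hop_dist_eq:
  assumes xs: "xs \<in> dary_words d r"
  shows "hop_dist (with_proj U) (f []) (f xs) = length xs"
  unfolding hop_dist_def
proof (rule Least_equality)
  show "\<exists>p. pre_digraph.awalk (with_proj U) (f []) p (f xs) \<and> length p = length xs"
    using xs
  proof (induction xs rule: rev_induct)
    case Nil
    then show ?case
      by (auto simp: pre_digraph.awalk_def cas_with_proj_eq)
  next
    case (snoc a xs)
    then have xs: "xs \<in> dary_words d r"
      by (auto simp: dary_words_iff)
    with snoc obtain p where
      p: "pre_digraph.awalk (with_proj U) (f []) p (f xs)" "length p = length xs"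
      by blast
    have "(xs, xs @ [a]) \<in> parcs (dary_tree d r)"
      using snoc.prems xs by (simp add: dary_arcs_iff)
    then have "(f xs, f (xs @ [a])) \<in> parcs U"
      by force
    then show ?case
      using p by (intro exI[of _ "p @ [(f xs, f (xs @ [a]))]"])
        (auto simp: pre_digraph.awalk_def cas_with_proj_eq pcas_snoc)
  qed
next
  fix n
  assume "\<exists>p. pre_digraph.awalk (with_proj U) (f []) p (f xs) \<and> length p = n"
  then obtain p where p: "set p \<subseteq> parcs U" "pcas (f []) p (f xs)" "length p = n"
    by (auto simp: pre_digraph.awalk_def cas_with_proj_eq)
  have "level (snd e) \<le> Suc (level (fst e))" if e: "e \<in> set p" for e
  proof -
    obtain ys zs where "e = (f ys, f zs)" "(ys, zs) \<in> parcs (dary_tree d r)"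
      using p(1) e by fastforce
    then show ?thesis
      by (auto simp: dary_arcs_iff level_f)
  qed
  then have "level (f xs) \<le> level (f []) + length p"
    using pcas_level_le[where lev = level] p(2) by blast
  moreover have "[] \<in> dary_words d r"
    by (simp add: dary_words_iff)
  ultimately show "length xs \<le> n"
    using xs p(3) by (simp add: level_f)
qed

text \<open>By injectivity a neighbour of \<open>f (xs @ [a])\<close> is the image of
  \<open>xs\<close> or of a one-letter extension of \<open>xs @ [a]\<close>. The extension is
  farther from the root.\<close>

lemma parent_eq:
  assumes xs: "xs @ [a] \<in> dary_words d r"
  shows "parent (with_proj U) (f []) (f (xs @ [a])) = f xs"
  unfolding parent_def
proof (rule the_equality)
  have "xs \<in> dary_words d r"
    using xs by (auto simp: dary_words_iff)
  moreover from this have "(xs, xs @ [a]) \<in> parcs (dary_tree d r)"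
    using xs by (simp add: dary_arcs_iff)
  ultimately show "f xs \<rightarrow>\<^bsub>with_proj U\<^esub> f (xs @ [a]) \<and>
      hop_dist (with_proj U) (f []) (f xs) < hop_dist (with_proj U) (f []) (f (xs @ [a]))"
    using xs by (force simp: hop_dist_eq)
next
  fix w
  assume w: "w \<rightarrow>\<^bsub>with_proj U\<^esub> f (xs @ [a]) \<and>
      hop_dist (with_proj U) (f []) w < hop_dist (with_proj U) (f []) (f (xs @ [a]))"
  then obtain ys zs where yz: "(ys, zs) \<in> parcs (dary_tree d r)" "w = f ys" "f zs = f (xs @ [a])"
    by auto
  then have "zs = xs @ [a]"
    using inj xs by (auto simp: dary_arcs_iff dest: inj_onD)
  then show "w = f xs"
    using w yz xs by (auto simp: dary_arcs_iff hop_dist_eq)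
qed

end

text \<open>Words are read backwards here, so that the last letter comes first.\<close>

primrec descend :: "(nat \<Rightarrow> 'a \<Rightarrow> nat \<Rightarrow> 'a) \<Rightarrow> 'a \<Rightarrow> nat list \<Rightarrow> 'a" where
  "descend c z [] = z"
| "descend c z (a # xs) = c (length xs) (descend c z xs) a"

section \<open>Growing the tree\<close>

locale phantom_setting = pair_graph G
  for G :: "'a pair_pre_digraph" +
  fixes d g h t r :: nat
    and Z :: "'a set"
    and z\<^sub>1 z\<^sub>2 z :: 'a
    and P :: "nat \<Rightarrow> 'a set"
    and \<Gamma> :: "nat \<Rightarrow> 'a set \<Rightarrow> 'a set"
  assumes d_pos: "d \<ge> 1"
    and K22_free: "free_of G K\<^bsub>2,2\<^esub>" and Kt_free: "free_of G K\<^bsub>t\<^esub>"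
    and Z_verts: "Z \<subseteq> pverts G" and card_Z: "card Z \<le> h"
    and Z0_Z: "{z\<^sub>1, z\<^sub>2, z} \<subseteq> Z" and clique_Z0: "clique G 3 {z\<^sub>1, z\<^sub>2, z}"
    and nbrs_z: "{y \<in> Z. z \<rightarrow>\<^bsub>G\<^esub> y} = {z\<^sub>1, z\<^sub>2}"
    and phantom: "phantom G {z\<^sub>1, z\<^sub>2, z} (d + g + 2 ^ h * t) r P \<Gamma>"
    and P_Z: "P r \<inter> Z = {z\<^sub>1, z\<^sub>2, z}"
begin

section \<open>Admissible tree vertices and their candidate children\<close>

abbreviation W :: "'a set" where
  "W \<equiv> Z - {z\<^sub>1, z\<^sub>2, z}"

text \<open>The invariant of tree vertices at depth \<open>i\<close>. Membership in
  \<open>P i\<close> puts the edges to \<open>z\<^sub>1\<close> and \<open>z\<^sub>2\<close> in the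
  domain of \<open>\<Gamma> (Suc i)\<close>, and having no neighbour in \<open>W\<close> makes the
  bound on common neighbours applicable.\<close>

definition good :: "nat \<Rightarrow> 'a \<Rightarrow> bool" where
  "good i u \<longleftrightarrow> u \<in> P i \<and> u \<notin> {z\<^sub>1, z\<^sub>2} \<and> z\<^sub>1 \<rightarrow>\<^bsub>G\<^esub> u \<and> z\<^sub>2 \<rightarrow>\<^bsub>G\<^esub> u \<and> (\<forall>y\<in>W. \<not> u \<rightarrow>\<^bsub>G\<^esub> y)"

definition clean :: "nat \<Rightarrow> 'a \<Rightarrow> 'a \<Rightarrow> 'a set" where
  "clean i u v = {x \<in> \<Gamma> (Suc i) {u, v}. \<not> (\<exists>y\<in>W. y \<rightarrow>\<^bsub>G\<^esub> x)}"

lemma z_distinct: "z\<^sub>1 \<noteq> z\<^sub>2" "z \<noteq> z\<^sub>1" "z \<noteq> z\<^sub>2"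
  using clique_Z0 unfolding clique_def by (auto simp: card_insert_if split: if_splits)

lemma z_adj: "z\<^sub>1 \<rightarrow>\<^bsub>G\<^esub> z\<^sub>2" "z\<^sub>1 \<rightarrow>\<^bsub>G\<^esub> z" "z\<^sub>2 \<rightarrow>\<^bsub>G\<^esub> z"
  using clique_Z0 z_distinct unfolding clique_def by blast+

lemma P_0: "P 0 = {z\<^sub>1, z\<^sub>2, z}" and P_r: "P r \<subseteq> pverts G"
  using phantom unfolding phantom_def by simp_all

lemma P_mono: "i \<le> j \<Longrightarrow> j \<le> r \<Longrightarrow> P i \<subseteq> P j"
proof (induction j rule: dec_induct)
  case (step j)
  have "\<forall>i\<in>{1..r}. P (i - 1) \<subseteq> P i"
    using phantom unfolding phantom_def by simp
  then have "P j \<subseteq> P (Suc j)"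
    using step.prems by force
  then show ?case
    using step by auto
qed simp

lemma Z0_P: "i \<le> r \<Longrightarrow> {z\<^sub>1, z\<^sub>2, z} \<subseteq> P i"
  using P_mono[of 0 i] P_0 by simp

text \<open>The root starts the construction: its only neighbours in \<open>Z\<close> are
  \<open>z\<^sub>1\<close> and \<open>z\<^sub>2\<close>, hence none lies in
  \<open>W\<close>.\<close>

lemma good_z: "good 0 z"
  using z_distinct z_adj P_0 nbrs_z unfolding good_def by auto

lemma good_edge:
  assumes "good i u" "i < r" "v \<in> {z\<^sub>1, z\<^sub>2}"
  shows "{u, v} \<in> edges (G \<restriction> P i)"
proof -
  have "v \<rightarrow>\<^bsub>G\<^esub> u"
    using assms unfolding good_def by blast
  moreover have "u \<in> P i" "v \<in> P i"
    using assms Z0_P[of i] unfolding good_def by auto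
  ultimately show ?thesis
    using edge_in_edges_induce adj_sym by metis
qed

lemma
  assumes "e \<in> edges (G \<restriction> P i)" "i < r"
  shows \<Gamma>_subset: "\<Gamma> (Suc i) e \<subseteq> P (Suc i) - P i"
    and \<Gamma>_card: "card (\<Gamma> (Suc i) e) = d + g + 2 ^ h * t"
    and \<Gamma>_adj: "u \<in> e \<Longrightarrow> x \<in> \<Gamma> (Suc i) e \<Longrightarrow> u \<rightarrow>\<^bsub>G\<^esub> x"
proof -
  have "Suc i \<in> {1..r}"
    using assms by simp
  then have "\<forall>e\<in>edges (G \<restriction> P i). \<Gamma> (Suc i) e \<subseteq> P (Suc i) - P i \<and>
      card (\<Gamma> (Suc i) e) = d + g + 2 ^ h * t \<and> (\<forall>u\<in>e. \<forall>x\<in>\<Gamma> (Suc i) e. u \<rightarrow>\<^bsub>G\<^esub> x)"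
    using phantom unfolding phantom_def by (metis diff_Suc_1)
  then show "\<Gamma> (Suc i) e \<subseteq> P (Suc i) - P i" "card (\<Gamma> (Suc i) e) = d + g + 2 ^ h * t"
    "u \<in> e \<Longrightarrow> x \<in> \<Gamma> (Suc i) e \<Longrightarrow> u \<rightarrow>\<^bsub>G\<^esub> x"
    using assms(1) by blast+
qed

lemma \<Gamma>_disjoint:
  assumes "i < r" "e \<in> edges (G \<restriction> P i)" "e' \<in> edges (G \<restriction> P i)"
    and "x \<in> \<Gamma> (Suc i) e" "x \<in> \<Gamma> (Suc i) e'"
  shows "e = e'"
proof -
  have "Suc i \<in> {1..r}"
    using assms by simp
  then have "disjoint_family_on (\<Gamma> (Suc i)) (edges (G \<restriction> P i))"
    using phantom unfolding phantom_def by (metis diff_Suc_1)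
  then show ?thesis
    using assms unfolding disjoint_family_on_def by blast
qed

text \<open>At most \<open>card W * t\<close> elements of \<open>\<Gamma> (Suc i) {u, v}\<close>
  have a neighbour in \<open>W\<close>. The summand \<open>2 ^ h * t\<close> in the size of the
  phantom's sets pays for them, and \<open>d + g\<close> remain.\<close>

lemma
  assumes "good i u" "i < r" "v \<in> {z\<^sub>1, z\<^sub>2}"
  shows card_clean: "d + g \<le> card (clean i u v)"
    and finite_clean: "finite (clean i u v)"
proof -
  let ?X = "\<Gamma> (Suc i) {u, v}"
  let ?B = "{x \<in> ?X. \<exists>y\<in>W. y \<rightarrow>\<^bsub>G\<^esub> x}"
  note e = good_edge[OF assms]
  have card_X: "card ?X = d + g + 2 ^ h * t"
    using \<Gamma>_card e assms(2) by blast
  \<comment> \<open>As \<open>d\<close> is positive the cardinality is nonzero, which rules out an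
    infinite set.\<close>
  then have fin: "finite ?X"
    using d_pos by (intro card_ge_0_finite) simp
  have "finite Z"
    using Z_verts pair_finite_verts finite_subset by blast
  \<comment> \<open>A vertex of \<open>P r\<close> that lies in \<open>Z\<close> is one of the
    triangle, and \<open>W\<close> leaves the triangle out.\<close>
  have "u \<in> P r"
    using assms P_mono[of i r] unfolding good_def by auto
  then have "u \<notin> W"
    using P_Z by blast
  then have "card ?B \<le> card W * t"
    using assms(1) \<open>finite Z\<close> \<Gamma>_adj[OF e assms(2)] unfolding good_def
    by (intro card_neighbours_of_set_le[OF K22_free Kt_free, of _ u]) auto
  also have "\<dots> \<le> 2 ^ h * t"
  proof -
    have "card W \<le> h"
      using card_mono[OF \<open>finite Z\<close>, of W] card_Z by simp
    also have "h \<le> 2 ^ h"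
      using less_exp[of h] by simp
    finally show ?thesis by simp
  qed
  finally have "card ?B \<le> 2 ^ h * t" .
  moreover have "clean i u v = ?X - ?B"
    unfolding clean_def by blast
  moreover have "card (?X - ?B) = card ?X - card ?B"
    using fin by (intro card_Diff_subset) auto
  ultimately show "d + g \<le> card (clean i u v)" "finite (clean i u v)"
    using card_X fin by auto
qed

text \<open>New vertices avoid \<open>P i\<close>, which contains \<open>z\<^sub>1\<close> and
  \<open>z\<^sub>2\<close>, so \<open>x\<close> differs from both. Being clean supplies the
  condition on \<open>W\<close>.\<close>

lemma good_childI:
  assumes "good i u" "i < r" "v \<in> {z\<^sub>1, z\<^sub>2}" "x \<in> clean i u v"
    and "z\<^sub>1 \<rightarrow>\<^bsub>G\<^esub> x" "z\<^sub>2 \<rightarrow>\<^bsub>G\<^esub> x"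
  shows "good (Suc i) x"
proof -
  have "x \<in> P (Suc i) - P i"
    using assms(4) \<Gamma>_subset[OF good_edge[OF assms(1-3)] assms(2)] unfolding clean_def by blast
  then show ?thesis
    using assms Z0_P[of i] adj_sym unfolding good_def clean_def by auto
qed

text \<open>If fewer than \<open>d\<close> clean vertices see both \<open>z\<^sub>1\<close> and
  \<open>z\<^sub>2\<close> on each of the two edges, then at least \<open>g\<close> of the
  \<open>d + g\<close> are left on each edge. These are the two sides of a crystal centred at
  \<open>u\<close>.\<close>

lemma crystal_or_common:
  assumes "good i u" "i < r"
  shows "(\<exists>S T. crystal (G \<restriction> P r) z\<^sub>1 z\<^sub>2 1 g S T \<and> anticomplete G (crystal_verts S T) W) \<or>
    (\<exists>v\<in>{z\<^sub>1, z\<^sub>2}. d \<le> card {x \<in> clean i u v. z\<^sub>1 \<rightarrow>\<^bsub>G\<^esub> x \<and> z\<^sub>2 \<rightarrow>\<^bsub>G\<^esub> x})"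
proof (rule disjCI)
  assume few: "\<not> (\<exists>v\<in>{z\<^sub>1, z\<^sub>2}. d \<le> card {x \<in> clean i u v. z\<^sub>1 \<rightarrow>\<^bsub>G\<^esub> x \<and> z\<^sub>2 \<rightarrow>\<^bsub>G\<^esub> x})"
  have exclusive: "\<exists>A. A \<subseteq> clean i u v \<and> card A = g \<and> (\<forall>x\<in>A. \<not> (z\<^sub>1 \<rightarrow>\<^bsub>G\<^esub> x \<and> z\<^sub>2 \<rightarrow>\<^bsub>G\<^esub> x))"
    if v: "v \<in> {z\<^sub>1, z\<^sub>2}" for v
  proof -
    let ?C = "{x \<in> clean i u v. z\<^sub>1 \<rightarrow>\<^bsub>G\<^esub> x \<and> z\<^sub>2 \<rightarrow>\<^bsub>G\<^esub> x}"
    have "card ?C < d"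
      using few v by force
    moreover have "card (clean i u v - ?C) = card (clean i u v) - card ?C"
      using finite_clean[OF assms v] by (intro card_Diff_subset) auto
    ultimately have "g \<le> card (clean i u v - ?C)"
      using card_clean[OF assms v] by linarith
    then obtain A where "A \<subseteq> clean i u v - ?C" "card A = g" "finite A"
      by (rule obtain_subset_with_card_n)
    then show ?thesis
      by blast
  qed
  obtain A where A: "A \<subseteq> clean i u z\<^sub>1" "card A = g" "\<forall>x\<in>A. \<not> (z\<^sub>1 \<rightarrow>\<^bsub>G\<^esub> x \<and> z\<^sub>2 \<rightarrow>\<^bsub>G\<^esub> x)"
    using exclusive[of z\<^sub>1] by blast
  obtain B where B: "B \<subseteq> clean i u z\<^sub>2" "card B = g" "\<forall>x\<in>B. \<not> (z\<^sub>1 \<rightarrow>\<^bsub>G\<^esub> x \<and> z\<^sub>2 \<rightarrow>\<^bsub>G\<^esub> x)"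
    using exclusive[of z\<^sub>2] by blast
  have e: "{u, z\<^sub>1} \<in> edges (G \<restriction> P i)" "{u, z\<^sub>2} \<in> edges (G \<restriction> P i)"
    using good_edge assms by blast+
  have AB: "A \<subseteq> \<Gamma> (Suc i) {u, z\<^sub>1}" "B \<subseteq> \<Gamma> (Suc i) {u, z\<^sub>2}"
    using A(1) B(1) unfolding clean_def by blast+
  have sub: "P (Suc i) \<subseteq> P r" "P i \<subseteq> P r" "z\<^sub>1 \<in> P i" "z\<^sub>2 \<in> P i"
    using P_mono[of "Suc i" r] P_mono[of i r] Z0_P[of i] assms(2) by auto
  have u: "u \<in> P i" "u \<noteq> z\<^sub>1" "u \<noteq> z\<^sub>2" "\<forall>y\<in>W. \<not> u \<rightarrow>\<^bsub>G\<^esub> y"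
    using assms(1) unfolding good_def by blast+
  have new: "A \<subseteq> P (Suc i) - P i" "B \<subseteq> P (Suc i) - P i"
    using AB \<Gamma>_subset[OF e(1) assms(2)] \<Gamma>_subset[OF e(2) assms(2)] by blast+
  \<comment> \<open>Distinct edges have disjoint images under \<open>\<Gamma> (Suc i)\<close>, which
    separates \<open>A\<close> from \<open>B\<close>.\<close>
  have "{u, z\<^sub>1} \<noteq> {u, z\<^sub>2}"
    using z_distinct u by (auto simp: doubleton_eq_iff)
  then have disj: "A \<inter> B = {}"
    using AB \<Gamma>_disjoint[OF assms(2) e] by blast
  \<comment> \<open>Lying in \<open>\<Gamma> (Suc i) {u, z\<^sub>1}\<close> forces adjacency to
    \<open>u\<close> and \<open>z\<^sub>1\<close>, so the neighbour that \<open>x\<close> misses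
    must be \<open>z\<^sub>2\<close>. Also \<open>x\<close> avoids \<open>P i\<close>, where
    \<open>z\<^sub>2\<close> lies.\<close>
  have "u \<rightarrow>\<^bsub>G\<^esub> x \<and> z\<^sub>1 \<rightarrow>\<^bsub>G\<^esub> x \<and> \<not> z\<^sub>2 \<rightarrow>\<^bsub>G\<^esub> x \<and> x \<noteq> z\<^sub>2" if "x \<in> A" for x
    using that A(3) AB(1) new(1) sub(4) \<Gamma>_adj[OF e(1) assms(2)] by blast
  moreover have "u \<rightarrow>\<^bsub>G\<^esub> x \<and> z\<^sub>2 \<rightarrow>\<^bsub>G\<^esub> x \<and> \<not> z\<^sub>1 \<rightarrow>\<^bsub>G\<^esub> x \<and> x \<noteq> z\<^sub>1" if "x \<in> B" for x
    using that B(3) AB(2) new(2) sub(3) \<Gamma>_adj[OF e(2) assms(2)] by blast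
  ultimately have "crystal (G \<restriction> P r) z\<^sub>1 z\<^sub>2 1 g {u} (\<lambda>i _. if i = 1 then A else B)"
    using z_adj(1) sub u A(2) B(2) new disj by (intro crystal_singletonI) blast+
  moreover have "anticomplete G (insert u (A \<union> B)) W"
    using A(1) B(1) u(4) adj_sym unfolding anticomplete_def clean_def by blast
  moreover have "crystal_verts {u} (\<lambda>i _. if i = 1 then A else B) = insert u (A \<union> B)"
    by (simp add: crystal_verts_def)
  ultimately show "\<exists>S T. crystal (G \<restriction> P r) z\<^sub>1 z\<^sub>2 1 g S T \<and> anticomplete G (crystal_verts S T) W"
    by metis
qed

text \<open>A labelling of \<open>d\<close> children of \<open>u\<close> by the letters below
  \<open>d\<close>. Stated as a predicate so that such labellings can be chosen for all good
  vertices at once.\<close>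

definition child_map :: "nat \<Rightarrow> 'a \<Rightarrow> (nat \<Rightarrow> 'a) \<Rightarrow> bool" where
  "child_map i u c \<longleftrightarrow> inj_on c {..<d} \<and>
     (\<forall>a<d. c a \<in> \<Gamma> (Suc i) {u, z\<^sub>1} \<union> \<Gamma> (Suc i) {u, z\<^sub>2} \<and> good (Suc i) (c a) \<and> u \<rightarrow>\<^bsub>G\<^esub> c a)"

lemma child_map_exists:
  assumes no_crystal:
      "\<not> (\<exists>S T. crystal (G \<restriction> P r) z\<^sub>1 z\<^sub>2 1 g S T \<and> anticomplete G (crystal_verts S T) W)"
    and u: "good i u" "i < r"
  shows "\<exists>c. child_map i u c"
proof -
  from crystal_or_common[OF u] no_crystal obtain v where
    v: "v \<in> {z\<^sub>1, z\<^sub>2}" "d \<le> card {x \<in> clean i u v. z\<^sub>1 \<rightarrow>\<^bsub>G\<^esub> x \<and> z\<^sub>2 \<rightarrow>\<^bsub>G\<^esub> x}"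
    by blast
  from v(2) obtain C where C: "C \<subseteq> {x \<in> clean i u v. z\<^sub>1 \<rightarrow>\<^bsub>G\<^esub> x \<and> z\<^sub>2 \<rightarrow>\<^bsub>G\<^esub> x}" "card C = d" "finite C"
    by (rule obtain_subset_with_card_n)
  then obtain c where c: "bij_betw c {..<d} C"
    using ex_bij_betw_nat_finite[OF C(3)] by (auto simp: atLeast0LessThan)
  have "x \<in> \<Gamma> (Suc i) {u, z\<^sub>1} \<union> \<Gamma> (Suc i) {u, z\<^sub>2} \<and> good (Suc i) x \<and> u \<rightarrow>\<^bsub>G\<^esub> x" if "x \<in> C" for x
  proof -
    have x: "x \<in> clean i u v" "z\<^sub>1 \<rightarrow>\<^bsub>G\<^esub> x" "z\<^sub>2 \<rightarrow>\<^bsub>G\<^esub> x"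
      using C that by blast+
    then show ?thesis
      using v(1) good_childI[OF u v(1)] \<Gamma>_adj[OF good_edge[OF u v(1)] u(2)]
      unfolding clean_def by blast
  qed
  then show ?thesis
    using c unfolding child_map_def bij_betw_def by blast
qed

section \<open>Embedding the words into the graph along chosen children\<close>

context
  fixes c :: "nat \<Rightarrow> 'a \<Rightarrow> nat \<Rightarrow> 'a"
  assumes c: "\<And>i u. good i u \<Longrightarrow> i < r \<Longrightarrow> child_map i u (c i u)"
begin

text \<open>The reversal lets appending a letter to a word correspond to stepping to a
  child.\<close>

definition embed :: "nat list \<Rightarrow> 'a" where
  "embed xs = descend c z (rev xs)"

lemma embed_simps: "embed [] = z" "embed (xs @ [a]) = c (length xs) (embed xs) a"
  by (simp_all add: embed_def)

lemma good_embed: "xs \<in> dary_words d r \<Longrightarrow> good (length xs) (embed xs)"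
proof (induction xs rule: rev_induct)
  case (snoc a xs)
  then have "good (length xs) (embed xs)" "length xs < r" "a < d"
    by (auto simp: dary_words_iff)
  then show ?case
    using c[of "length xs" "embed xs"] by (simp add: embed_simps child_map_def)
qed (simp add: embed_simps good_z)

lemma embed_snoc:
  assumes "xs @ [a] \<in> dary_words d r"
  shows "embed (xs @ [a]) \<in> \<Gamma> (Suc (length xs)) {embed xs, z\<^sub>1} \<union> \<Gamma> (Suc (length xs)) {embed xs, z\<^sub>2}"
    and "embed xs \<rightarrow>\<^bsub>G\<^esub> embed (xs @ [a])"
    and "\<Gamma> (Suc (length xs)) {embed xs, z\<^sub>1} \<union> \<Gamma> (Suc (length xs)) {embed xs, z\<^sub>2}
           \<subseteq> P (Suc (length xs)) - P (length xs)"
proof -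
  have xs: "good (length xs) (embed xs)" "length xs < r" "a < d"
    using assms by (auto simp: dary_words_iff intro!: good_embed)
  show "embed (xs @ [a]) \<in> \<Gamma> (Suc (length xs)) {embed xs, z\<^sub>1} \<union> \<Gamma> (Suc (length xs)) {embed xs, z\<^sub>2}"
    "embed xs \<rightarrow>\<^bsub>G\<^esub> embed (xs @ [a])"
    using c[OF xs(1,2)] xs(3) unfolding child_map_def embed_simps by blast+
  show "\<Gamma> (Suc (length xs)) {embed xs, z\<^sub>1} \<union> \<Gamma> (Suc (length xs)) {embed xs, z\<^sub>2}
      \<subseteq> P (Suc (length xs)) - P (length xs)"
    using \<Gamma>_subset[OF good_edge[OF xs(1,2)] xs(2)] by blast
qed

text \<open>The image of \<open>ys @ [a]\<close> is taken from a set that avoids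
  \<open>P (length ys)\<close>, and the sets \<open>P i\<close> increase. Hence the image alone
  determines the length of the word.\<close>

lemma embed_new:
  assumes "xs \<in> dary_words d r" "i < length xs"
  shows "embed xs \<notin> P i"
proof (cases xs rule: rev_cases)
  case (snoc ys a)
  then have "embed xs \<notin> P (length ys)"
    using embed_snoc assms(1) by blast
  moreover have "P i \<subseteq> P (length ys)"
    using assms snoc by (intro P_mono) (auto simp: dary_words_iff)
  ultimately show ?thesis by blast
qed (use assms in simp)

text \<open>A common child lies in the \<open>\<Gamma>\<close>-images of an edge at each parent.
  Disjointness makes these edges equal, and as \<open>embed xs\<close> is neither
  \<open>z\<^sub>1\<close> nor \<open>z\<^sub>2\<close>, the parents agree.\<close>

lemma embed_snoc_inj:
  assumes "xs @ [a] \<in> dary_words d r" "ys @ [b] \<in> dary_words d r" "length xs = length ys"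
    and eq: "embed (xs @ [a]) = embed (ys @ [b])"
  shows "embed xs = embed ys"
proof -
  have xs: "good (length xs) (embed xs)" "good (length xs) (embed ys)" "length xs < r"
    using assms(1-3) good_embed[of xs] good_embed[of ys] by (simp_all add: dary_words_iff)
  obtain v where v: "v \<in> {z\<^sub>1, z\<^sub>2}" "embed (xs @ [a]) \<in> \<Gamma> (Suc (length xs)) {embed xs, v}"
    using embed_snoc(1)[OF assms(1)] by blast
  obtain w where w: "w \<in> {z\<^sub>1, z\<^sub>2}" "embed (xs @ [a]) \<in> \<Gamma> (Suc (length xs)) {embed ys, w}"
    using embed_snoc(1)[OF assms(2)] eq assms(3) by auto
  have "{embed xs, v} = {embed ys, w}"
    using \<Gamma>_disjoint[OF xs(3) good_edge[OF xs(1,3) v(1)] good_edge[OF xs(2,3) w(1)] v(2) w(2)] .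
  moreover have "embed xs \<notin> {z\<^sub>1, z\<^sub>2}"
    using xs(1) unfolding good_def by blast
  ultimately show ?thesis
    using w(1) by (metis doubleton_eq_iff)
qed

text \<open>Equal images give equal lengths by \<open>embed_new\<close>, then equal parents by
  \<open>embed_snoc_inj\<close>, hence equal prefixes by induction. The last letters agree since
  siblings are labelled injectively.\<close>

lemma inj_embed: "inj_on embed (dary_words d r)"
proof (rule inj_onI)
  fix xs ys
  assume "xs \<in> dary_words d r" "ys \<in> dary_words d r" "embed xs = embed ys"
  then show "xs = ys"
  proof (induction xs arbitrary: ys rule: rev_induct)
    case Nil
    then have "embed ys \<in> P 0"
      using good_embed[of "[]"] by (simp add: good_def)
    then show ?case
      using embed_new[of ys 0] Nil by auto
  next
    case (snoc a xs)
    have "embed (xs @ [a]) \<in> P (length (xs @ [a]))" "embed ys \<in> P (length ys)"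
      using good_embed snoc.prems unfolding good_def by blast+
    then have len: "length ys = length (xs @ [a])"
      using embed_new snoc.prems by (metis linorder_neqE_nat)
    then obtain ys' b where ys: "ys = ys' @ [b]"
      by (cases ys rule: rev_cases) auto
    have words: "xs \<in> dary_words d r" "ys' \<in> dary_words d r" "length xs < r" "a < d" "b < d"
      using snoc.prems ys by (auto simp: dary_words_iff)
    have "embed xs = embed ys'"
      using snoc.prems ys len by (intro embed_snoc_inj[of xs a ys' b]) simp_all
    then have "xs = ys'"
      using snoc.IH words(1,2) by blast
    moreover have "inj_on (c (length xs) (embed xs)) {..<d}"
      using c good_embed words(1,3) unfolding child_map_def by blast
    then have "a = b"
      using snoc.prems(3) ys words(4,5) \<open>xs = ys'\<close> by (auto simp: embed_simps dest: inj_onD)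
    ultimately show ?case
      using ys by simp
  qed
qed

interpretation dary_image embed d r
  by unfold_locales (rule inj_embed)

lemma subgraph_U: "subgraph (with_proj U) (with_proj G)"
proof (rule subgraphI)
  have "embed xs \<in> pverts G" if "xs \<in> dary_words d r" for xs
    using good_embed[OF that] unfolding good_def by (auto dest: wellformed')
  then show "verts (with_proj U) \<subseteq> verts (with_proj G)"
    by auto
  \<comment> \<open>Tree arcs run both ways: \<open>embed_snoc\<close> covers parent to child, and
    symmetry of the graph the reverse.\<close>
  have "(embed xs, embed ys) \<in> parcs G" if "(xs, ys) \<in> parcs (dary_tree d r)" for xs ys
    using that embed_snoc(2) adj_sym by (auto simp: dary_arcs_iff)
  then show "arcs (with_proj U) \<subseteq> arcs (with_proj G)"
    by auto
  show "compatible (with_proj G) (with_proj U)"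
    by (simp add: compatible_def)
  show "wf_digraph (with_proj G)"
    by (rule wf_digraph)
  show "wf_digraph (with_proj U)"
    by unfold_locales (auto simp: dary_arcs_iff)
qed

lemma tree_exists:
  "\<exists>U :: 'a pair_pre_digraph.
        subgraph (with_proj U) G \<and>
        rooted_iso (dary_tree d r) [] (with_proj U) z \<and>
        {z\<^sub>1, z\<^sub>2} \<inter> pverts U = {} \<and>
        (\<forall>x\<in>{z\<^sub>1, z\<^sub>2}. \<forall>u\<in>pverts U. x \<rightarrow>\<^bsub>G\<^esub> u) \<and>
        (\<forall>i\<in>{1..r}. \<forall>u\<in>pverts U. hop_dist (with_proj U) z u = i \<longrightarrow>
           u \<in> \<Gamma> i {parent (with_proj U) z u, z\<^sub>1} \<union> \<Gamma> i {parent (with_proj U) z u, z\<^sub>2} \<and>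
           \<Gamma> i {parent (with_proj U) z u, z\<^sub>1} \<union> \<Gamma> i {parent (with_proj U) z u, z\<^sub>2} \<subseteq> P i - P (i - 1)) \<and>
        pverts U \<inter> Z = {z}"
proof (intro exI[of _ U] conjI ballI impI)
  have nil: "[] \<in> dary_words d r"
    by (simp add: dary_words_iff)
  have good_U: "good (length xs) (embed xs)" if "xs \<in> dary_words d r" for xs
    using good_embed that .
  show "subgraph (with_proj U) G"
    by (rule subgraph_U)
  show "rooted_iso (dary_tree d r) [] (with_proj U) z"
    using rooted_iso_map_pdigraph[OF pair_wf_digraph_dary_tree inj_embed nil] embed_simps(1) by simp
  show "{z\<^sub>1, z\<^sub>2} \<inter> pverts U = {}"
    using good_U unfolding good_def by auto
  show "x \<rightarrow>\<^bsub>G\<^esub> u" if "x \<in> {z\<^sub>1, z\<^sub>2}" "u \<in> pverts U" for x u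
    using that good_U unfolding good_def by auto
  show "pverts U \<inter> Z = {z}"
  proof (intro equalityI subsetI)
    fix u
    \<comment> \<open>Tree vertices lie in \<open>P r\<close>, which meets \<open>Z\<close> only in
      the triangle, and they avoid \<open>z\<^sub>1\<close> and \<open>z\<^sub>2\<close>.\<close>
    assume "u \<in> pverts U \<inter> Z"
    then obtain xs where xs: "xs \<in> dary_words d r" "u = embed xs" "u \<in> Z"
      by auto
    then have "u \<in> P r"
      using good_U[OF xs(1)] P_mono[of "length xs" r] by (auto simp: good_def dary_words_iff)
    then have "u = z"
      using xs P_Z good_U[OF xs(1)] unfolding good_def by blast
    then show "u \<in> {z}" by simp
  qed (use Z0_Z nil embed_simps(1) in force)
  fix i u
  assume i: "i \<in> {1..r}" and "u \<in> pverts U" and dist: "hop_dist (with_proj U) z u = i"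
  then obtain ys where ys: "ys \<in> dary_words d r" "u = embed ys"
    by auto
  then have "length ys = i"
    using dist hop_dist_eq embed_simps(1) by simp
  \<comment> \<open>Since \<open>i\<close> is at least 1, the word is nonempty and its last letter
    can be split off to expose the parent.\<close>
  then obtain xs a where xs: "xs @ [a] \<in> dary_words d r" "u = embed (xs @ [a])" "i = Suc (length xs)"
    using i ys by (cases ys rule: rev_cases) auto
  then have par: "parent (with_proj U) z u = embed xs"
    using parent_eq embed_simps(1) by simp
  show "u \<in> \<Gamma> i {parent (with_proj U) z u, z\<^sub>1} \<union> \<Gamma> i {parent (with_proj U) z u, z\<^sub>2}"
    using embed_snoc(1)[OF xs(1)] xs(2,3) unfolding par by simp
  show "\<Gamma> i {parent (with_proj U) z u, z\<^sub>1} \<union> \<Gamma> i {parent (with_proj U) z u, z\<^sub>2} \<subseteq> P i - P (i - 1)"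
    using embed_snoc(3)[OF xs(1)] xs(3) unfolding par by simp
qed

end

end

theorem theorem4p1:
  fixes d g h t r :: nat
    and G :: "'a pair_pre_digraph"
    and Z :: "'a set"
    and z\<^sub>1 z\<^sub>2 z :: 'a
    and P :: "nat \<Rightarrow> 'a set"
    and \<Gamma> :: "nat \<Rightarrow> 'a set \<Rightarrow> 'a set"
  assumes "d \<ge> 1" and "g \<ge> 1" and "h \<ge> 1" and "t \<ge> 1"
    and "pair_graph G"
    and "free_of G K\<^bsub>2,2\<^esub>" and "free_of G K\<^bsub>t\<^esub>"
    and "Z \<subseteq> pverts G" and "card Z \<le> h"
    and "{z\<^sub>1, z\<^sub>2, z} \<subseteq> Z" and "clique G 3 {z\<^sub>1, z\<^sub>2, z}"
    and "{y \<in> Z. z \<rightarrow>\<^bsub>G\<^esub> y} = {z\<^sub>1, z\<^sub>2}"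
    and "phantom G {z\<^sub>1, z\<^sub>2, z} (d + g + 2 ^ h * t) r P \<Gamma>"
    and "P r \<inter> Z = {z\<^sub>1, z\<^sub>2, z}"
  shows
    "(\<exists>S T. crystal (G \<restriction> P r) z\<^sub>1 z\<^sub>2 1 g S T \<and>
        anticomplete G (crystal_verts S T) (Z - {z\<^sub>1, z\<^sub>2, z}))
     \<or>
     (\<exists>U :: 'a pair_pre_digraph.
        subgraph (with_proj U) G \<and>
        rooted_iso (dary_tree d r) [] (with_proj U) z \<and>
        {z\<^sub>1, z\<^sub>2} \<inter> pverts U = {} \<and>
        (\<forall>x\<in>{z\<^sub>1, z\<^sub>2}. \<forall>u\<in>pverts U. x \<rightarrow>\<^bsub>G\<^esub> u) \<and>
        (\<forall>i\<in>{1..r}. \<forall>u\<in>pverts U. hop_dist (with_proj U) z u = i \<longrightarrow>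
           u \<in> \<Gamma> i {parent (with_proj U) z u, z\<^sub>1} \<union> \<Gamma> i {parent (with_proj U) z u, z\<^sub>2} \<and>
           \<Gamma> i {parent (with_proj U) z u, z\<^sub>1} \<union> \<Gamma> i {parent (with_proj U) z u, z\<^sub>2} \<subseteq> P i - P (i - 1)) \<and>
        pverts U \<inter> Z = {z})"
proof (rule disj_imp[THEN iffD2], rule impI)
  interpret phantom_setting G d g h t r Z z\<^sub>1 z\<^sub>2 z P \<Gamma>
    using assms by (intro phantom_setting.intro phantom_setting_axioms.intro)
  assume "\<not> (\<exists>S T. crystal (G \<restriction> P r) z\<^sub>1 z\<^sub>2 1 g S T \<and>
    anticomplete G (crystal_verts S T) (Z - {z\<^sub>1, z\<^sub>2, z}))"
  \<comment> \<open>Without a crystal every good vertex below depth \<open>r\<close> has a labelling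
    of children. With the conditions placed under the existential quantifier, one choice function
    serves all \<open>i\<close> and \<open>u\<close>.\<close>
  then have "\<forall>i u. \<exists>c. good i u \<longrightarrow> i < r \<longrightarrow> child_map i u c"
    using child_map_exists by blast
  then obtain c where "\<And>i u. good i u \<Longrightarrow> i < r \<Longrightarrow> child_map i u (c i u)"
    by metis
  then show "\<exists>U :: 'a pair_pre_digraph.
        subgraph (with_proj U) G \<and>
        rooted_iso (dary_tree d r) [] (with_proj U) z \<and>
        {z\<^sub>1, z\<^sub>2} \<inter> pverts U = {} \<and>
        (\<forall>x\<in>{z\<^sub>1, z\<^sub>2}. \<forall>u\<in>pverts U. x \<rightarrow>\<^bsub>G\<^esub> u) \<and>
        (\<forall>i\<in>{1..r}. \<forall>u\<in>pverts U. hop_dist (with_proj U) z u = i \<longrightarrow>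
           u \<in> \<Gamma> i {parent (with_proj U) z u, z\<^sub>1} \<union> \<Gamma> i {parent (with_proj U) z u, z\<^sub>2} \<and>
           \<Gamma> i {parent (with_proj U) z u, z\<^sub>1} \<union> \<Gamma> i {parent (with_proj U) z u, z\<^sub>2} \<subseteq> P i - P (i - 1)) \<and>
        pverts U \<inter> Z = {z}"
    by (rule tree_exists)
qed

end
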